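(* For every $0<\delta<1/2$, $$\kappa_{\mathrm{HC}}(\delta)\le\kappa_{\mathrm{bal}}(\delta)<\kappa_H(\delta).$$ More precisely, let $(a,b)$ be any minimizer of the closed whole-cube problem, let $P_0=\frac{(a-b)(1-a-b)}{a(1-a)}$, and put $$q=\frac{a(1-a)(1-P_0)}{1-2b}=\frac{b(1-b)}{1-2b}>0 .$$ On the exact balanced spectral boundary with $x=a$, $u=at$, $v=(1-a)t$ (that is, $\eta=\sin^2(at)$, $\rho=\sin^2((1-a)t)$ and $\Gamma_{\mathrm{HC}}(a,\eta,\rho,z)=1-2\delta$) there is a smooth function $z=z(t)$ of small $t\ge0$, giving the spectral-boundary value of $z$, such that as $t\downarrow0$ $$z(t)=b+qt+O(t^2),$$ $$\Phi_{\mathrm{bal}}(a,t;\delta)=\kappa_H(\delta)-q\,H_2'(b)\,t+2a(1-a)t^2\log_2(1/t)+O(t^2).$$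
   Context: $H_2(t)=-t\log_2t-(1-t)\log_2(1-t)$, $0\log_20=0$. Whole-cube exponent: $\Gamma_H(a,b)=\frac{2(a-b)(1-a-b)}{\sqrt{a(1-a)}}$ and $\kappa_H(\delta)=\inf\{H_2(a)-H_2(b):0\le b<a\le\frac12,\ \Gamma_H(a,b)>1-2\delta\}$. The closed whole-cube problem is to minimize $H_2(a)-H_2(b)$ over the compact region $0<a\le\frac12$, $0\le b\le a$, $\Gamma_H(a,b)\ge1-2\delta$. Honeycomb exponent: for $0<x\le\frac12$, $0\le\eta,\rho<\frac12$, $0\le z\le\frac12$ put $A=(1-x)(1-2\eta)$, $B=x(1-2\rho)$, $E=1-2z$; $\mathcal D_{\mathrm{HC}}$ is the set of such $(x,\eta,\rho,z)$ with $|A-B|\le E\le A+B$. Put $P=\frac{E^2-(A-B)^2}{4AB}$, $$\Gamma_{\mathrm{HC}}=2\sqrt{x(1-x)}\Big[P\big(\sqrt{(1-\eta)(1-\rho)}+\sqrt{\eta\rho}\big)+(1-P)\big(\sqrt{\rho(1-\eta)}+\sqrt{\eta(1-\rho)}\big)\Big],$$ $\Phi_{\mathrm{HC}}=H_2(x)+(1-x)H_2(\eta)+xH_2(\rho)-H_2(z)$, and $\kappa_{\mathrm{HC}}(\delta)=\inf\{\Phi_{\mathrm{HC}}:(x,\eta,\rho,z)\in\mathcal D_{\mathrm{HC}},\ \Gamma_{\mathrm{HC}}>1-2\delta\}$. Balanced exponent: for $0<x\le\frac12$, $0<t<\frac{\pi}{4(1-x)}$ let $S_+=\sqrt{x(1-x)}\cos((1-2x)t)$,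 $S_-=\sqrt{x(1-x)}\sin t$, $A_{\mathrm{bal}}=(1-x)\cos(2xt)$, $B_{\mathrm{bal}}=x\cos(2(1-x)t)$, $$P_{\mathrm{bal}}=\frac{(1-2\delta)/2-S_-}{S_+-S_-},\quad E_{\mathrm{bal}}=\sqrt{(A_{\mathrm{bal}}-B_{\mathrm{bal}})^2+4A_{\mathrm{bal}}B_{\mathrm{bal}}P_{\mathrm{bal}}},\quad z_{\mathrm{bal}}=\frac{1-E_{\mathrm{bal}}}2,$$ $\Phi_{\mathrm{bal}}(x,t;\delta)=H_2(x)+(1-x)H_2(\sin^2(xt))+xH_2(\sin^2((1-x)t))-H_2(z_{\mathrm{bal}}(x,t;\delta))$. $\kappa_{\mathrm{bal}}(\delta)$ is the infimum of $\Phi_{\mathrm{bal}}(x,t;\delta)$ over pairs $(x,t)$ in this range with $0<P_{\mathrm{bal}}<1$ and $0<E_{\mathrm{bal}}<1$. (With $\eta=\sin^2(xt)$, $\rho=\sin^2((1-x)t)$, $z=z_{\mathrm{bal}}$ one has $\Gamma_{\mathrm{HC}}=1-2\delta$ and $\Phi_{\mathrm{HC}}=\Phi_{\mathrm{bal}}$.) *)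

theory Defs
  imports "HOL-Analysis.Analysis" "HOL-Library.Landau_Symbols"
begin

(* The convention 0 log 0 = 0 is automatic for the term below. *)
definition H2 :: "real \<Rightarrow> real" where
  "H2 t = - t * log 2 t - (1 - t) * log 2 (1 - t)"

definition Gamma_H :: "real \<Rightarrow> real \<Rightarrow> real" where
  "Gamma_H a b = 2 * (a - b) * (1 - a - b) / sqrt (a * (1 - a))"

(* The three exponents below are infima of real sets.  For 0 < \<delta> < 1/2 these sets are nonempty
   and bounded below (lemmas at the end), so the real-valued Inf is the true infimum. *)
definition kappa_H :: "real \<Rightarrow> real" where
  "kappa_H \<delta> = Inf {H2 a - H2 b | a b. 0 \<le> b \<and> b < a \<and> a \<le> 1/2 \<and> Gamma_H a b > 1 - 2 * \<delta>}"

definition closed_whole_cube_region :: "real \<Rightarrow> (real \<times> real) set" where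
  "closed_whole_cube_region \<delta> =
     {(a, b). 0 < a \<and> a \<le> 1/2 \<and> 0 \<le> b \<and> b \<le> a \<and> Gamma_H a b \<ge> 1 - 2 * \<delta>}"

definition closed_whole_cube_minimizer :: "real \<Rightarrow> real \<times> real \<Rightarrow> bool" where
  "closed_whole_cube_minimizer \<delta> =
     is_arg_min (\<lambda>(a, b). H2 a - H2 b) (\<lambda>p. p \<in> closed_whole_cube_region \<delta>)"

definition A_HC :: "real \<Rightarrow> real \<Rightarrow> real" where
  "A_HC x \<eta> = (1 - x) * (1 - 2 * \<eta>)"

definition B_HC :: "real \<Rightarrow> real \<Rightarrow> real" where
  "B_HC x \<rho> = x * (1 - 2 * \<rho>)"

definition E_HC :: "real \<Rightarrow> real" where
  "E_HC z = 1 - 2 * z"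

definition D_HC :: "(real \<times> real \<times> real \<times> real) set" where
  "D_HC = {(x, \<eta>, \<rho>, z).
     0 < x \<and> x \<le> 1/2 \<and> 0 \<le> \<eta> \<and> \<eta> < 1/2 \<and> 0 \<le> \<rho> \<and> \<rho> < 1/2 \<and> 0 \<le> z \<and> z \<le> 1/2 \<and>
     \<bar>A_HC x \<eta> - B_HC x \<rho>\<bar> \<le> E_HC z \<and> E_HC z \<le> A_HC x \<eta> + B_HC x \<rho>}"

definition P_HC :: "real \<Rightarrow> real \<Rightarrow> real \<Rightarrow> real \<Rightarrow> real" where
  "P_HC x \<eta> \<rho> z =
     ((E_HC z)\<^sup>2 - (A_HC x \<eta> - B_HC x \<rho>)\<^sup>2) / (4 * A_HC x \<eta> * B_HC x \<rho>)"

definition Gamma_HC :: "real \<Rightarrow> real \<Rightarrow> real \<Rightarrow> real \<Rightarrow> real" where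
  "Gamma_HC x \<eta> \<rho> z = 2 * sqrt (x * (1 - x)) *
     (P_HC x \<eta> \<rho> z * (sqrt ((1 - \<eta>) * (1 - \<rho>)) + sqrt (\<eta> * \<rho>)) +
      (1 - P_HC x \<eta> \<rho> z) * (sqrt (\<rho> * (1 - \<eta>)) + sqrt (\<eta> * (1 - \<rho>))))"

definition Phi_HC :: "real \<Rightarrow> real \<Rightarrow> real \<Rightarrow> real \<Rightarrow> real" where
  "Phi_HC x \<eta> \<rho> z = H2 x + (1 - x) * H2 \<eta> + x * H2 \<rho> - H2 z"

definition kappa_HC :: "real \<Rightarrow> real" where
  "kappa_HC \<delta> = Inf {Phi_HC x \<eta> \<rho> z | x \<eta> \<rho> z.
     (x, \<eta>, \<rho>, z) \<in> D_HC \<and> Gamma_HC x \<eta> \<rho> z > 1 - 2 * \<delta>}"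

definition S_plus :: "real \<Rightarrow> real \<Rightarrow> real" where
  "S_plus x t = sqrt (x * (1 - x)) * cos ((1 - 2 * x) * t)"

definition S_minus :: "real \<Rightarrow> real \<Rightarrow> real" where
  "S_minus x t = sqrt (x * (1 - x)) * sin t"

definition A_bal :: "real \<Rightarrow> real \<Rightarrow> real" where
  "A_bal x t = (1 - x) * cos (2 * x * t)"

definition B_bal :: "real \<Rightarrow> real \<Rightarrow> real" where
  "B_bal x t = x * cos (2 * (1 - x) * t)"

definition P_bal :: "real \<Rightarrow> real \<Rightarrow> real \<Rightarrow> real" where
  "P_bal x t \<delta> = ((1 - 2 * \<delta>) / 2 - S_minus x t) / (S_plus x t - S_minus x t)"

definition E_bal :: "real \<Rightarrow> real \<Rightarrow> real \<Rightarrow> real" where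
  "E_bal x t \<delta> = sqrt ((A_bal x t - B_bal x t)\<^sup>2 + 4 * A_bal x t * B_bal x t * P_bal x t \<delta>)"

definition z_bal :: "real \<Rightarrow> real \<Rightarrow> real \<Rightarrow> real" where
  "z_bal x t \<delta> = (1 - E_bal x t \<delta>) / 2"

definition Phi_bal :: "real \<Rightarrow> real \<Rightarrow> real \<Rightarrow> real" where
  "Phi_bal x t \<delta> = H2 x + (1 - x) * H2 ((sin (x * t))\<^sup>2) + x * H2 ((sin ((1 - x) * t))\<^sup>2)
     - H2 (z_bal x t \<delta>)"

definition D_bal :: "real \<Rightarrow> (real \<times> real) set" where
  "D_bal \<delta> = {(x, t). 0 < x \<and> x \<le> 1/2 \<and> 0 < t \<and> t < pi / (4 * (1 - x)) \<and>
     0 < P_bal x t \<delta> \<and> P_bal x t \<delta> < 1 \<and> 0 < E_bal x t \<delta> \<and> E_bal x t \<delta> < 1}"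

definition kappa_bal :: "real \<Rightarrow> real" where
  "kappa_bal \<delta> = Inf {Phi_bal x t \<delta> | x t. (x, t) \<in> D_bal \<delta>}"

(* f is C^infinity on S, with one-sided derivatives at points of S that are not interior:
   D k is the k-th derivative of f relative to S. *)
definition smooth_real_on :: "real set \<Rightarrow> (real \<Rightarrow> real) \<Rightarrow> bool" where
  "smooth_real_on S f \<longleftrightarrow>
     (\<exists>D. D 0 = f \<and>
       (\<forall>k::nat. \<forall>t\<in>S. (D k has_real_derivative D (Suc k) t) (at t within S)))"

lemma H2_nonneg:
  assumes "0 \<le> t" "t \<le> 1"
  shows "0 \<le> H2 t"
proof -
  have "t * log 2 t \<le> 0" if "0 \<le> t" "t \<le> 1" for t :: real
    using that by (cases "t = 0") (auto simp: mult_le_0_iff)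
  from this[of t] this[of "1 - t"] show ?thesis
    using assms by (simp add: H2_def)
qed

lemma H2_le:
  assumes "0 \<le> t" "t \<le> 1"
  shows "H2 t \<le> 1 / ln 2"
proof -
  have *: "- (t * log 2 t) \<le> (1 - t) / ln 2" if "0 \<le> t" "t \<le> 1" for t :: real
  proof (cases "t = 0")
    case False
    hence "ln (1 / t) \<le> 1 / t - 1"
      using that by (intro ln_le_minus_one) simp
    hence "t * ln (1 / t) \<le> t * (1 / t - 1)"
      using that by (intro mult_left_mono)
    hence "- (t * ln t) \<le> 1 - t"
      using that False by (simp add: ln_div algebra_simps)
    hence "- (t * ln t) / ln 2 \<le> (1 - t) / ln 2"
      by (rule divide_right_mono) simp
    thus ?thesis by (simp add: log_def)
  qed simp
  from add_mono[OF *[of t] *[of "1 - t"]] show ?thesis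
    using assms by (simp add: H2_def add_divide_distrib[symmetric])
qed

lemma kappa_H_set:
  assumes "0 < \<delta>" "\<delta> < 1/2"
  defines "K \<equiv> {H2 a - H2 b | a b. 0 \<le> b \<and> b < a \<and> a \<le> 1/2 \<and> Gamma_H a b > 1 - 2 * \<delta>}"
  shows "K \<noteq> {}" and "bdd_below K"
proof -
  have "Gamma_H (1/2) 0 = 1"
    by (simp add: Gamma_H_def real_sqrt_divide)
  hence "H2 (1/2) - H2 0 \<in> K"
    unfolding K_def using assms(1) by force
  thus "K \<noteq> {}" by blast
  show "bdd_below K"
  proof (rule bdd_belowI[where m = "- (1 / ln 2)"])
    fix k assume "k \<in> K"
    then obtain a b where "k = H2 a - H2 b" "0 \<le> b" "b < a" "a \<le> 1/2"
      by (auto simp: K_def)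
    thus "- (1 / ln 2) \<le> k"
      using H2_nonneg[of a] H2_le[of b] by simp
  qed
qed

lemma kappa_HC_set:
  assumes "0 < \<delta>" "\<delta> < 1/2"
  defines "K \<equiv> {Phi_HC x \<eta> \<rho> z | x \<eta> \<rho> z.
     (x, \<eta>, \<rho>, z) \<in> D_HC \<and> Gamma_HC x \<eta> \<rho> z > 1 - 2 * \<delta>}"
  shows "K \<noteq> {}" and "bdd_below K"
proof -
  have "Gamma_HC (1/2) 0 0 0 = 1" "(1/2, 0, 0, 0) \<in> D_HC"
    by (simp_all add: Gamma_HC_def P_HC_def D_HC_def A_HC_def B_HC_def E_HC_def real_sqrt_divide)
  hence "Phi_HC (1/2) 0 0 0 \<in> K"
    unfolding K_def using assms(1) by force
  thus "K \<noteq> {}" by blast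
  show "bdd_below K"
  proof (rule bdd_belowI[where m = "- (1 / ln 2)"])
    fix k assume "k \<in> K"
    then obtain x \<eta> \<rho> z where k: "k = Phi_HC x \<eta> \<rho> z" and D: "(x, \<eta>, \<rho>, z) \<in> D_HC"
      by (auto simp: K_def)
    have "0 \<le> (1 - x) * H2 \<eta>" "0 \<le> x * H2 \<rho>" "0 \<le> H2 x" "H2 z \<le> 1 / ln 2"
      using D by (auto simp: D_HC_def intro!: mult_nonneg_nonneg H2_nonneg H2_le)
    thus "- (1 / ln 2) \<le> k"
      by (simp add: k Phi_HC_def)
  qed
qed

lemma kappa_bal_set:
  assumes "0 < \<delta>" "\<delta> < 1/2"
  defines "K \<equiv> {Phi_bal x t \<delta> | x t. (x, t) \<in> D_bal \<delta>}"
  shows "K \<noteq> {}" and "bdd_below K"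
proof -
  define s where "s = (1 - 2 * \<delta>) / 2"
  define t where "t = arcsin s"
  have s: "0 < s" "s < 1/2" using assms by (auto simp: s_def)
  have t: "0 < t" "t < pi / 2" "sin t = s"
    using s arcsin_less_arcsin[of 0 s] arcsin_less_arcsin[of s 1] by (auto simp: t_def)
  have c: "0 < cos t" "cos t \<le> 1" using t by (auto intro: cos_gt_zero)
  have P: "P_bal (1/2) t \<delta> = s / (1 - s)"
  proof -
    have "P_bal (1/2) t \<delta> = (s - s / 2) / (1/2 - s / 2)"
      unfolding P_bal_def S_plus_def S_minus_def t(3) s_def[symmetric]
      by (simp add: real_sqrt_divide)
    thus ?thesis using s by (simp add: field_simps)
  qed
  hence P01: "0 < P_bal (1/2) t \<delta>" "P_bal (1/2) t \<delta> < 1"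
    using s by simp_all
  have E: "E_bal (1/2) t \<delta> = sqrt ((cos t)\<^sup>2 * P_bal (1/2) t \<delta>)"
    by (simp add: E_bal_def A_bal_def B_bal_def power2_eq_square)
  have "(cos t)\<^sup>2 * P_bal (1/2) t \<delta> \<le> 1 * P_bal (1/2) t \<delta>"
    using c P01 by (intro mult_right_mono) (auto simp: abs_square_le_1)
  hence "(cos t)\<^sup>2 * P_bal (1/2) t \<delta> < 1"
    using P01 by linarith
  hence "0 < E_bal (1/2) t \<delta>" "E_bal (1/2) t \<delta> < 1"
    unfolding E using c P01 by simp_all
  hence "(1/2, t) \<in> D_bal \<delta>"
    using t P01 by (simp add: D_bal_def)
  thus "K \<noteq> {}" by (auto simp: K_def)
  show "bdd_below K"
  proof (rule bdd_belowI[where m = "- (1 / ln 2)"])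
    fix k assume "k \<in> K"
    then obtain x t where k: "k = Phi_bal x t \<delta>" and D: "(x, t) \<in> D_bal \<delta>"
      by (auto simp: K_def)
    have sq: "0 \<le> (sin u)\<^sup>2" "(sin u)\<^sup>2 \<le> 1" for u :: real
      by (simp_all add: abs_square_le_1)
    have "0 \<le> (1 - x) * H2 ((sin (x * t))\<^sup>2)" "0 \<le> x * H2 ((sin ((1 - x) * t))\<^sup>2)"
      "0 \<le> H2 x" "H2 (z_bal x t \<delta>) \<le> 1 / ln 2"
      using D sq by (auto simp: D_bal_def z_bal_def intro!: mult_nonneg_nonneg H2_nonneg H2_le)
    thus "- (1 / ln 2) \<le> k"
      by (simp add: k Phi_bal_def)
  qed
qed

end

(* Let (a, b) be a minimizer of the closed whole-cube problem. The spectral constraint is tight at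
   (a, b), since otherwise b could be raised, and b > 0, since at b = 0 the infinite slope of H_2
   beats the Lipschitz cost of moving a. On the balanced boundary with x = a the quantity E^2 is
   analytic in t and equals (1 - 2 b)^2 at t = 0. There the derivatives of A_bal and B_bal vanish, so
   the linear term of z comes from P_bal alone and equals q t. As q H_2'(b) > 0, the linear gain
   -q H_2'(b) t dominates the entropy cost of order t^2 log(1/t), hence kappa_bal < kappa_H. For the
   weak inequality, lowering z below z_bal pushes a balanced point strictly inside the spectral
   constraint while changing Phi_HC continuously. *)
theory Submission
  imports Defs "HOL-Real_Asymp.Real_Asymp" "HOL-Complex_Analysis.Cauchy_Integral_Formula"
begin

section \<open>Calculus of the binary entropy and second-order Taylor remainders\<close>

lemma H2_0 [simp]: "H2 0 = 0"
  by (simp add: H2_def)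

lemma H2_has_real_derivative:
  assumes "0 < y" "y < 1"
  shows "(H2 has_real_derivative log 2 (1 - y) - log 2 y) (at y)"
proof -
  have "((\<lambda>t. - t * log 2 t - (1 - t) * log 2 (1 - t)) has_real_derivative
      - log 2 y - 1 / ln 2 + log 2 (1 - y) + 1 / ln 2) (at y)"
    using assms by (auto intro!: derivative_eq_intros simp: divide_simps)
  thus ?thesis by (simp add: H2_def[abs_def])
qed

lemma deriv_H2:
  assumes "0 < y" "y < 1"
  shows "deriv H2 y = log 2 (1 - y) - log 2 y"
  using H2_has_real_derivative[OF assms] by (rule DERIV_imp_deriv)

lemma deriv_H2_pos:
  assumes "0 < y" "y < 1/2"
  shows "0 < deriv H2 y"
  using assms by (simp add: deriv_H2)

lemma isCont_H2:
  assumes "0 < y" "y < 1"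
  shows "isCont H2 y"
  using H2_has_real_derivative[OF assms] by (rule DERIV_isCont)

text \<open>The slope is infinite at 0, so differentiability cannot give continuity there; the limit
  t log t -> 0 is used instead.\<close>

lemma continuous_on_H2: "continuous_on {0..1/2} H2"
proof -
  have "continuous (at x within {0..1/2}) H2" if x: "x \<in> {0..1/2}" for x
  proof (cases "x = 0")
    case True
    have "(H2 \<longlongrightarrow> H2 0) (at_right 0)"
      unfolding H2_0 unfolding H2_def log_def by real_asymp
    moreover have "at_right 0 = at 0 within {0..1/2::real}"
      by (simp add: at_within_Icc_at_right)
    ultimately show ?thesis using True by (simp add: continuous_within)
  next
    case False
    with x show ?thesis
      by (auto intro!: continuous_at_imp_continuous_at_within[OF isCont_H2])
  qed
  thus ?thesis by (simp add: continuous_on_eq_continuous_within)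
qed

text \<open>The criterion asks for a positive derivative only in the open interval, which admits the
  endpoints 0, where the slope is infinite, and 1/2, where it vanishes.\<close>

lemma H2_strict_mono:
  assumes "0 \<le> x" "x < y" "y \<le> 1/2"
  shows "H2 x < H2 y"
proof (rule DERIV_pos_imp_increasing_open[OF \<open>x < y\<close>])
  fix u assume "x < u" "u < y"
  hence "0 < u" "u < 1/2" using assms by auto
  thus "\<exists>d. (H2 has_real_derivative d) (at u) \<and> d > 0"
    using H2_has_real_derivative[of u] deriv_H2_pos[of u] deriv_H2[of u] by auto
qed (use continuous_on_subset[OF continuous_on_H2] assms in auto)

text \<open>With y = sin^2 (c t) = c^2 t^2 + O(t^4), the term - y log2 y contributes 2 c^2 t^2 log2
  (1/t) + O(t^2), while - (1 - y) log2 (1 - y) is O(t^2).\<close>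

lemma H2_sin_squared_expansion:
  fixes c :: real
  assumes "c > 0"
  shows "(\<lambda>t. H2 ((sin (c * t))\<^sup>2) - 2 * c\<^sup>2 * t\<^sup>2 * log 2 (1 / t)) \<in> O[at_right 0](\<lambda>t. t\<^sup>2)"
  using assms unfolding H2_def log_def by real_asymp

text \<open>Lagrange's remainder is f2(u) t^2 / 2 with u in (0, t). A continuous \<open>f2\<close>
  may be unbounded on the half-open interval, so it is bounded on the compact half
  \<open>{0..\<epsilon>/2}\<close>.\<close>

lemma second_order_taylor_bigo:
  fixes f f1 f2 :: "real \<Rightarrow> real"
  assumes "\<epsilon> > 0"
    and f: "\<And>t. t \<in> {0..<\<epsilon>} \<Longrightarrow> (f has_real_derivative f1 t) (at t)"
    and f1: "\<And>t. t \<in> {0..<\<epsilon>} \<Longrightarrow> (f1 has_real_derivative f2 t) (at t)"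
    and f2: "continuous_on {0..<\<epsilon>} f2"
  shows "(\<lambda>t. f t - (f 0 + f1 0 * t)) \<in> O[at_right 0](\<lambda>t. t\<^sup>2)"
proof -
  have "compact (f2 ` {0..\<epsilon>/2})"
    using \<open>\<epsilon> > 0\<close> by (intro compact_continuous_image continuous_on_subset[OF f2]) auto
  then obtain M where "\<forall>y \<in> f2 ` {0..\<epsilon>/2}. norm y \<le> M"
    using compact_imp_bounded bounded_iff by metis
  hence M: "\<bar>f2 t\<bar> \<le> M" if "t \<in> {0..\<epsilon>/2}" for t
    using that by auto
  have "\<bar>f t - (f 0 + f1 0 * t)\<bar> \<le> M / 2 * t\<^sup>2" if t: "0 < t" "t < \<epsilon>/2" for t
  proof -
    define diff where "diff = (\<lambda>m::nat. if m = 0 then f else if m = 1 then f1 else f2)"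
    have d: "\<forall>m u. m < 2 \<and> 0 \<le> u \<and> u \<le> t \<longrightarrow> DERIV (diff m) u :> diff (Suc m) u"
      using f f1 t by (auto simp: diff_def less_2_cases_iff)
    have "diff 0 = f" by (simp add: diff_def)
    from Maclaurin[of t 2 diff f, OF _ _ this d] t obtain u where u: "0 < u" "u < t"
      "f t = (\<Sum>m<2. diff m 0 / fact m * t ^ m) + diff 2 u / fact 2 * t ^ 2" by auto
    hence "f t - (f 0 + f1 0 * t) = f2 u / 2 * t\<^sup>2"
      by (simp add: diff_def numeral_2_eq_2)
    moreover have "\<bar>f2 u\<bar> \<le> M" using u t by (intro M) auto
    ultimately show ?thesis by (simp only: abs_mult) (simp add: mult_right_mono)
  qed
  thus ?thesis
    using \<open>\<epsilon> > 0\<close>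
    by (intro bigoI[of _ "M / 2"]) (auto simp: eventually_at_right_field intro!: exI[of _ "\<epsilon>/2"])
qed

section \<open>Minimizers of the closed whole-cube problem\<close>

text \<open>Multiplying out the square root turns the constraint into an inequality between
  functions continuous on the whole plane, on which closedness of the region rests.\<close>

lemma Gamma_H_ge_iff:
  assumes "0 < a" "a < 1"
  shows "R \<le> Gamma_H a b \<longleftrightarrow> R * sqrt (a * (1 - a)) \<le> 2 * (a - b) * (1 - a - b)"
  using assms by (simp add: Gamma_H_def pos_le_divide_eq)

lemma isCont_Gamma_H: "isCont (Gamma_H a) b"
  unfolding Gamma_H_def divide_inverse by (intro continuous_intros)

lemma closed_whole_cube_minimizer_iff:
  "closed_whole_cube_minimizer \<delta> (a, b) \<longleftrightarrow> (a, b) \<in> closed_whole_cube_region \<delta> \<and>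
     (\<forall>a' b'. (a', b') \<in> closed_whole_cube_region \<delta> \<longrightarrow> H2 a - H2 b \<le> H2 a' - H2 b')"
  unfolding closed_whole_cube_minimizer_def is_arg_min_def by (auto simp: not_less)

text \<open>The condition 0 < a is not closed. The constraint implies R <= 2 sqrt (a (1 - a)), hence
  a >= R^2/4, and with this bound the region is a closed subset of a box.\<close>

lemma closed_whole_cube_minimizer_exists:
  assumes "0 < \<delta>" "\<delta> < 1/2"
  obtains a b where "closed_whole_cube_minimizer \<delta> (a, b)"
proof -
  define R where "R = 1 - 2 * \<delta>"
  have R: "0 < R" "R < 1" using assms by (auto simp: R_def)
  define K where "K = {p :: real \<times> real. R * sqrt (fst p * (1 - fst p)) \<le>
      2 * (fst p - snd p) * (1 - fst p - snd p)} \<inter> {p. snd p \<le> fst p} \<inter> ({R\<^sup>2/4..1/2} \<times> {0..1/2})"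
  have region: "closed_whole_cube_region \<delta> = K"
  proof (intro set_eqI iffI; clarify)
    fix a b assume "(a, b) \<in> closed_whole_cube_region \<delta>"
    hence ab: "0 < a" "a \<le> 1/2" "0 \<le> b" "b \<le> a" "R \<le> Gamma_H a b"
      by (auto simp: closed_whole_cube_region_def R_def)
    hence G: "R * sqrt (a * (1 - a)) \<le> 2 * (a - b) * (1 - a - b)"
      by (simp add: Gamma_H_ge_iff)
    \<comment> \<open>Since (a - b) (1 - a - b) = a (1 - a) - b (1 - b), the numerator is largest at
      b = 0.\<close>
    have "b * b \<le> b * 1" using ab by (intro mult_left_mono) auto
    hence "2 * (a - b) * (1 - a - b) \<le> 2 * (a * (1 - a))"
      by (simp add: algebra_simps)
    also have "\<dots> = 2 * sqrt (a * (1 - a)) * sqrt (a * (1 - a))"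
      using ab by simp
    finally have "R * sqrt (a * (1 - a)) \<le> 2 * sqrt (a * (1 - a)) * sqrt (a * (1 - a))"
      using G by linarith
    hence "R \<le> 2 * sqrt (a * (1 - a))" using ab by simp
    hence "R\<^sup>2 \<le> (2 * sqrt (a * (1 - a)))\<^sup>2" using R by (intro power_mono) auto
    also have "\<dots> = 4 * (a * (1 - a))" using ab by (simp add: power_mult_distrib)
    finally have "R\<^sup>2 / 4 \<le> a * (1 - a)" by simp
    also have "\<dots> \<le> a" using ab by (simp add: algebra_simps)
    finally show "(a, b) \<in> K" using ab G by (auto simp: K_def)
  next
    fix a b assume "(a, b) \<in> K"
    hence ab: "R\<^sup>2 / 4 \<le> a" "a \<le> 1/2" "0 \<le> b" "b \<le> a"
      "R * sqrt (a * (1 - a)) \<le> 2 * (a - b) * (1 - a - b)" by (auto simp: K_def)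
    moreover have "0 < a" using R by (intro less_le_trans[OF _ ab(1)]) simp
    ultimately show "(a, b) \<in> closed_whole_cube_region \<delta>"
      by (simp add: closed_whole_cube_region_def Gamma_H_ge_iff flip: R_def)
  qed
  have "closed {p :: real \<times> real. R * sqrt (fst p * (1 - fst p)) \<le>
      2 * (fst p - snd p) * (1 - fst p - snd p)}" "closed {p :: real \<times> real. snd p \<le> fst p}"
    by (intro closed_Collect_le continuous_intros)+
  hence "compact K" unfolding K_def
    by (intro closed_Int_compact closed_Int compact_Times compact_Icc)
  moreover have "(1/2, 0) \<in> K"
    using R power_le_one[of R 2] by (simp add: K_def real_sqrt_divide)
  hence "K \<noteq> {}" by blast
  moreover have "continuous_on K (\<lambda>p. H2 (fst p) - H2 (snd p))"
    by (intro continuous_intros continuous_on_compose2[OF continuous_on_H2])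
      (auto simp: K_def intro: order_trans[OF zero_le_power2])
  ultimately obtain p where "p \<in> K" "\<forall>p'\<in>K. H2 (fst p) - H2 (snd p) \<le> H2 (fst p') - H2 (snd p')"
    using continuous_attains_inf by blast
  hence "closed_whole_cube_minimizer \<delta> (fst p, snd p)"
    unfolding closed_whole_cube_minimizer_iff region by fastforce
  thus ?thesis by (rule that)
qed

text \<open>Moving a by \<open>C * \<epsilon>\<close> changes the entropy by O(\<epsilon>) whatever
  C is, while \<open>H2 \<epsilon> / \<epsilon>\<close> tends to infinity. This rules out minimizers
  with b = 0.\<close>

lemma H2_perturbation:
  assumes "0 < a" "a < 1"
  shows "\<forall>\<^sub>F \<epsilon> in at_right 0. H2 (a + C * \<epsilon>) - H2 \<epsilon> < H2 a"
proof -
  have "((\<lambda>\<epsilon>. H2 (a + C * \<epsilon>)) has_real_derivative (log 2 (1 - a) - log 2 a) * C) (at 0)"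
    by (rule DERIV_chain2[where f = H2])
      (use assms H2_has_real_derivative[of a] in \<open>auto intro!: derivative_eq_intros\<close>)
  hence "((\<lambda>\<epsilon>. (H2 (a + C * \<epsilon>) - H2 a) / \<epsilon>) \<longlongrightarrow> (log 2 (1 - a) - log 2 a) * C) (at_right 0)"
    by (auto simp: DERIV_def intro: tendsto_mono[OF at_le])
  moreover have "filterlim (\<lambda>\<epsilon>. H2 \<epsilon> / \<epsilon>) at_top (at_right 0)"
    unfolding H2_def log_def by real_asymp
  ultimately have "filterlim (\<lambda>\<epsilon>. - ((H2 (a + C * \<epsilon>) - H2 a) / \<epsilon>) + H2 \<epsilon> / \<epsilon>) at_top (at_right 0)"
    by (intro filterlim_tendsto_add_at_top[OF tendsto_minus])
  hence "\<forall>\<^sub>F \<epsilon> in at_right 0. 0 < - ((H2 (a + C * \<epsilon>) - H2 a) / \<epsilon>) + H2 \<epsilon> / \<epsilon>"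
    unfolding filterlim_at_top_dense by blast
  thus ?thesis using eventually_at_right_less[of 0]
    by eventually_elim (simp add: field_simps)
qed

lemma closed_whole_cube_minimizer_interior:
  assumes "0 < \<delta>" "\<delta> < 1/2" and min: "closed_whole_cube_minimizer \<delta> (a, b)"
  shows "0 < b" "b < a" "a \<le> 1/2" "Gamma_H a b = 1 - 2 * \<delta>"
proof -
  define R where "R = 1 - 2 * \<delta>"
  have R: "0 < R" "R < 1" using assms by (auto simp: R_def)
  have ab: "0 < a" "a \<le> 1/2" "0 \<le> b" "b \<le> a" and G: "R \<le> Gamma_H a b"
    using min by (auto simp: closed_whole_cube_minimizer_iff closed_whole_cube_region_def R_def)
  have le: "H2 a - H2 b \<le> H2 a' - H2 b'"
    if "0 < a'" "a' \<le> 1/2" "0 \<le> b'" "b' \<le> a'" "R \<le> Gamma_H a' b'" for a' b'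
    using min that by (auto simp: closed_whole_cube_minimizer_iff closed_whole_cube_region_def R_def)
  show "a \<le> 1/2" by fact
  show "b < a" using G R ab by (cases "b = a") (auto simp: Gamma_H_def)
  show tight: "Gamma_H a b = 1 - 2 * \<delta>"
  proof (rule ccontr)
    assume "Gamma_H a b \<noteq> 1 - 2 * \<delta>"
    hence "R < Gamma_H a b" using G by (simp add: R_def)
    moreover have "(Gamma_H a \<longlongrightarrow> Gamma_H a b) (at_right b)"
      using isCont_Gamma_H[of b a] by (auto simp: isCont_def intro: tendsto_mono[OF at_le])
    ultimately have "\<forall>\<^sub>F b' in at_right b. R < Gamma_H a b'"
      by (simp add: order_tendstoD)
    moreover have "\<forall>\<^sub>F b' in at_right b. b' \<in> {b<..<a}"
      using \<open>b < a\<close> by (rule eventually_at_right_real)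
    ultimately have "\<forall>\<^sub>F b' in at_right b. R < Gamma_H a b' \<and> b' \<in> {b<..<a}"
      by (rule eventually_conj)
    then obtain b' where "R < Gamma_H a b'" "b' \<in> {b<..<a}"
      using eventually_happens'[OF trivial_limit_at_right_real] by blast
    with le[of a b'] H2_strict_mono[of b b'] ab show False by simp
  qed
  have "b \<noteq> 0"
  proof
    assume "b = 0"
    hence R_eq: "R = 2 * sqrt (a * (1 - a))"
      using tight ab real_div_sqrt[of "a * (1 - a)"] by (simp add: Gamma_H_def R_def mult.assoc)
    \<comment> \<open>The value a = 1/2 would make R equal to 1; hence there is room to raise
      a.\<close>
    have "a < 1/2" using R R_eq ab by (cases "a = 1/2") (auto simp: real_sqrt_divide)
    \<comment> \<open>Any slope above \<open>2 / (1 - 2 * a)\<close> keeps \<open>(a + C * \<epsilon>, \<epsilon>)\<close> feasible to first order.\<close>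
    define C where "C = 3 / (1 - 2 * a)"
    have C: "C > 1" "C * (1 - 2 * a) = 3" using ab \<open>a < 1/2\<close> by (auto simp: C_def field_simps)
    \<comment> \<open>The slack of the cleared constraint along (a + C \<epsilon>, \<epsilon>). It
      vanishes at 0 because R = 2 sqrt (a (1 - a)), and its slope there is C (1 - 2 a) - 2 = 1, so
      it is positive for small \<epsilon> > 0.\<close>
    define g where "g = (\<lambda>\<epsilon>. 2 * ((a + C * \<epsilon>) - \<epsilon>) * (1 - (a + C * \<epsilon>) - \<epsilon>)
      - R * sqrt ((a + C * \<epsilon>) * (1 - (a + C * \<epsilon>))))"
    have "g 0 = 0" using ab by (simp add: g_def R_eq)
    have "(g has_real_derivative 2 * (C - 1) * (1 - a) - 2 * a * (C + 1)
        - R * ((C * (1 - a) - a * C) / (2 * sqrt (a * (1 - a))))) (at 0)"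
      unfolding g_def using ab
      by (auto intro!: derivative_eq_intros simp: field_simps)
    also have "R * (y / (2 * sqrt (a * (1 - a)))) = y" for y
      using ab by (simp add: R_eq)
    also have "2 * (C - 1) * (1 - a) - 2 * a * (C + 1) - (C * (1 - a) - a * C) = C * (1 - 2 * a) - 2"
      by (simp add: algebra_simps)
    finally have "(g has_real_derivative 1) (at 0)" by (simp add: C)
    from DERIV_pos_inc_right[OF this] obtain d where d: "d > 0" "\<And>h. 0 < h \<Longrightarrow> h < d \<Longrightarrow> 0 < g h"
      using \<open>g 0 = 0\<close> by auto
    have "\<forall>\<^sub>F \<epsilon> in at_right 0. \<epsilon> \<in> {0<..<min d ((1/2 - a) / C)}"
      using d C \<open>a < 1/2\<close> by (intro eventually_at_right_real) simp
    moreover have "\<forall>\<^sub>F \<epsilon> in at_right 0. H2 (a + C * \<epsilon>) - H2 \<epsilon> < H2 a"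
      using ab by (intro H2_perturbation) auto
    ultimately have "\<forall>\<^sub>F \<epsilon> in at_right 0. \<epsilon> \<in> {0<..<min d ((1/2 - a) / C)} \<and> H2 (a + C * \<epsilon>) - H2 \<epsilon> < H2 a"
      by (rule eventually_conj)
    then obtain \<epsilon> where "\<epsilon> \<in> {0<..<min d ((1/2 - a) / C)}" "H2 (a + C * \<epsilon>) - H2 \<epsilon> < H2 a"
      using eventually_happens'[OF trivial_limit_at_right_real] by blast
    hence \<epsilon>: "0 < \<epsilon>" "\<epsilon> < d" "\<epsilon> < (1/2 - a) / C" "H2 (a + C * \<epsilon>) - H2 \<epsilon> < H2 a"
      by simp_all
    define a' where "a' = a + C * \<epsilon>"
    have "0 < C * \<epsilon>" using \<epsilon> C by simp
    moreover have "1 * \<epsilon> \<le> C * \<epsilon>" using \<epsilon> C by (intro mult_right_mono) auto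
    moreover have "C * \<epsilon> < 1/2 - a" using \<epsilon> C by (simp add: field_simps)
    ultimately have a': "0 < a'" "\<epsilon> \<le> a'" "a' \<le> 1/2" using ab by (simp_all add: a'_def)
    have "0 < g \<epsilon>" using d \<epsilon> by simp
    hence "R \<le> Gamma_H a' \<epsilon>"
      using a' by (subst Gamma_H_ge_iff) (auto simp: g_def a'_def)
    hence "H2 a - H2 b \<le> H2 (a + C * \<epsilon>) - H2 \<epsilon>"
      using le[OF a'(1,3) _ a'(2)] \<epsilon> by (simp add: a'_def)
    with \<epsilon> \<open>b = 0\<close> show False by simp
  qed
  with ab show "0 < b" by simp
qed

text \<open>Competitors for the strict constraint lie in the closed region. Conversely, the points
  (a, b') with b' slightly below b satisfy the constraint strictly, and their values tend to that of
  (a, b); b > 0 leaves room for them.\<close>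

lemma kappa_H_eq:
  assumes "0 < \<delta>" "\<delta> < 1/2" and min: "closed_whole_cube_minimizer \<delta> (a, b)"
  shows "kappa_H \<delta> = H2 a - H2 b"
proof (rule antisym)
  note ab = closed_whole_cube_minimizer_interior[OF assms]
  show "H2 a - H2 b \<le> kappa_H \<delta>"
    unfolding kappa_H_def
    using kappa_H_set(1)[OF assms(1,2)] min
    by (intro cInf_greatest) (auto simp: closed_whole_cube_minimizer_iff closed_whole_cube_region_def)
  have "\<forall>\<^sub>F b' in at_left b. b' \<in> {0<..<b}"
    using ab by (intro eventually_at_left_real)
  hence "\<forall>\<^sub>F b' in at_left b. kappa_H \<delta> \<le> H2 a - H2 b'"
  proof eventually_elim
    case (elim b')
    \<comment> \<open>Twice this product is the gain in the numerator of \<open>Gamma_H\<close> when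
      b is lowered to b'.\<close>
    have "0 < (b - b') * (1 - b - b')" using elim ab by (intro mult_pos_pos) auto
    hence "2 * (a - b) * (1 - a - b) < 2 * (a - b') * (1 - a - b')"
      by (simp add: algebra_simps)
    hence "Gamma_H a b < Gamma_H a b'"
      unfolding Gamma_H_def using ab by (intro divide_strict_right_mono) auto
    thus ?case
      unfolding kappa_H_def using elim ab
      by (intro cInf_lower kappa_H_set(2) assms) force
  qed
  moreover have "((\<lambda>b'. H2 a - H2 b') \<longlongrightarrow> H2 a - H2 b) (at_left b)"
    using isCont_H2[of b] ab
    by (intro tendsto_intros) (auto simp: isCont_def intro: tendsto_mono[OF at_le])
  ultimately show "kappa_H \<delta> \<le> H2 a - H2 b"
    by (intro tendsto_lowerbound[where F = "at_left b"]) auto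
qed

section \<open>Balanced points inside the honeycomb problem\<close>

text \<open>With u = x t and v = (1 - x) t the roots in \<open>Gamma_HC\<close> become sines and
  cosines of u and v, and its two brackets are cos (v - u) and sin (u + v). The bound on t says v <
  pi/4, which keeps A and B positive. The value t = 0 is included for the start of the
  expansion.\<close>

lemma balanced_HC:
  fixes x t z :: real
  assumes x: "0 < x" "x \<le> 1/2" and t: "0 \<le> t" "t < pi / (4 * (1 - x))"
  defines "\<eta> \<equiv> (sin (x * t))\<^sup>2" and "\<rho> \<equiv> (sin ((1 - x) * t))\<^sup>2"
  shows A_HC_balanced: "A_HC x \<eta> = A_bal x t" and B_HC_balanced: "B_HC x \<rho> = B_bal x t"
    and A_bal_pos: "0 < A_bal x t" and B_bal_pos: "0 < B_bal x t"
    and S_minus_less_S_plus: "S_minus x t < S_plus x t"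
    and Gamma_HC_balanced: "Gamma_HC x \<eta> \<rho> z =
      2 * (P_HC x \<eta> \<rho> z * S_plus x t + (1 - P_HC x \<eta> \<rho> z) * S_minus x t)"
    and D_HC_balanced: "0 \<le> z \<Longrightarrow> z \<le> 1/2 \<Longrightarrow> 0 \<le> P_HC x \<eta> \<rho> z \<Longrightarrow> P_HC x \<eta> \<rho> z \<le> 1 \<Longrightarrow>
      (x, \<eta>, \<rho>, z) \<in> D_HC"
proof -
  define u where "u = x * t"
  define v where "v = (1 - x) * t"
  have "0 \<le> v" using x t unfolding v_def by (intro mult_nonneg_nonneg) auto
  moreover have "v < pi / 4" using x t by (simp add: v_def field_simps)
  ultimately have v: "0 \<le> v" "v < pi / 4" by auto
  have "x * t \<le> (1 - x) * t" using x t by (intro mult_right_mono) auto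
  hence uv: "0 \<le> u" "u \<le> v" using x t by (auto simp: u_def v_def)
  have cos_double: "cos (2 * w) = 1 - 2 * (sin w)\<^sup>2" for w :: real
    by (simp add: cos_double cos_squared_eq)
  show A: "A_HC x \<eta> = A_bal x t" and B: "B_HC x \<rho> = B_bal x t"
    using cos_double[of u] cos_double[of v]
    by (simp_all only: A_HC_def A_bal_def B_HC_def B_bal_def \<eta>_def \<rho>_def u_def v_def mult.assoc)
  have c: "0 < cos (2 * u)" "0 < cos (2 * v)" "0 < cos u" "0 < cos v" "0 \<le> sin u" "0 \<le> sin v"
    using uv v by (auto intro!: cos_gt_zero_pi sin_ge_zero)
  have "A_bal x t = (1 - x) * cos (2 * u)" "B_bal x t = x * cos (2 * v)"
    by (simp_all only: A_bal_def B_bal_def u_def v_def mult.assoc)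
  thus A0: "0 < A_bal x t" and B0: "0 < B_bal x t"
    using c x by simp_all
  have \<eta>\<rho>: "\<eta> < 1/2" "\<rho> < 1/2" "0 \<le> \<eta>" "0 \<le> \<rho>"
    using c cos_double[of u] cos_double[of v] by (auto simp: \<eta>_def \<rho>_def u_def v_def)
  \<comment> \<open>The arguments satisfy (1 - 2 x) t < pi/2 - t, which is again v < pi/4, and
    cosine decreases on [0, pi].\<close>
  have "sin t = cos (pi / 2 - t)" by (simp add: cos_diff)
  also have "\<dots> < cos ((1 - 2 * x) * t)"
    using uv v x t by (intro cos_monotone_0_pi) (auto simp: u_def v_def algebra_simps)
  finally show S: "S_minus x t < S_plus x t"
    unfolding S_plus_def S_minus_def using x by (intro mult_strict_left_mono) auto
  have "sqrt ((1 - \<eta>) * (1 - \<rho>)) = cos u * cos v" "sqrt (\<eta> * \<rho>) = sin u * sin v"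
    "sqrt (\<rho> * (1 - \<eta>)) = sin v * cos u" "sqrt (\<eta> * (1 - \<rho>)) = sin u * cos v"
    using c by (simp_all add: \<eta>_def \<rho>_def u_def v_def real_sqrt_mult flip: cos_squared_eq)
  hence "Gamma_HC x \<eta> \<rho> z = 2 * sqrt (x * (1 - x)) *
     (P_HC x \<eta> \<rho> z * cos (v - u) + (1 - P_HC x \<eta> \<rho> z) * sin (u + v))"
    by (simp add: Gamma_HC_def cos_diff sin_add algebra_simps)
  moreover have "v - u = (1 - 2 * x) * t" "u + v = t"
    by (simp_all add: u_def v_def algebra_simps)
  ultimately show "Gamma_HC x \<eta> \<rho> z =
      2 * (P_HC x \<eta> \<rho> z * S_plus x t + (1 - P_HC x \<eta> \<rho> z) * S_minus x t)"
    by (simp add: S_plus_def S_minus_def algebra_simps)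
  \<comment> \<open>E^2 interpolates between (A - B)^2 at P = 0 and (A + B)^2 at P = 1, so the
    bounds on P give |A - B| <= E <= A + B.\<close>
  assume z: "0 \<le> z" "z \<le> 1/2" and P: "0 \<le> P_HC x \<eta> \<rho> z" "P_HC x \<eta> \<rho> z \<le> 1"
  have "(E_HC z)\<^sup>2 = (A_bal x t - B_bal x t)\<^sup>2 + 4 * A_bal x t * B_bal x t * P_HC x \<eta> \<rho> z"
    using A0 B0 by (simp add: P_HC_def A B)
  moreover have "0 \<le> 4 * A_bal x t * B_bal x t * P_HC x \<eta> \<rho> z"
    using A0 B0 P by simp
  moreover have "4 * A_bal x t * B_bal x t * P_HC x \<eta> \<rho> z \<le> 4 * A_bal x t * B_bal x t * 1"
    using A0 B0 P by (intro mult_left_mono) auto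
  ultimately have "(A_bal x t - B_bal x t)\<^sup>2 \<le> (E_HC z)\<^sup>2" "(E_HC z)\<^sup>2 \<le> (A_bal x t + B_bal x t)\<^sup>2"
    by (auto simp: power2_eq_square algebra_simps)
  moreover have "0 \<le> E_HC z" using z by (simp add: E_HC_def)
  ultimately have "\<bar>A_bal x t - B_bal x t\<bar> \<le> E_HC z" "E_HC z \<le> A_bal x t + B_bal x t"
    using A0 B0 abs_le_square_iff[of _ "E_HC z"] power2_le_imp_le[of "E_HC z"] by auto
  thus "(x, \<eta>, \<rho>, z) \<in> D_HC"
    using x \<eta>\<rho> z by (simp add: D_HC_def A B)
qed

text \<open>\<open>E_bal\<close> comes from solving the formula for P for E. Its positivity makes
  the radicand positive, so that squaring undoes the root.\<close>

lemma P_HC_z_bal: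
  fixes x t :: real
  assumes x: "0 < x" "x \<le> 1/2" and t: "0 \<le> t" "t < pi / (4 * (1 - x))"
    and E: "0 < E_bal x t \<delta>"
  shows "P_HC x ((sin (x * t))\<^sup>2) ((sin ((1 - x) * t))\<^sup>2) (z_bal x t \<delta>) = P_bal x t \<delta>"
proof -
  have "(E_bal x t \<delta>)\<^sup>2 = (A_bal x t - B_bal x t)\<^sup>2 + 4 * A_bal x t * B_bal x t * P_bal x t \<delta>"
    using E by (simp add: E_bal_def)
  moreover have "E_HC (z_bal x t \<delta>) = E_bal x t \<delta>"
    by (simp add: E_HC_def z_bal_def diff_divide_distrib)
  ultimately show ?thesis
    using A_bal_pos[OF assms(1-4)] B_bal_pos[OF assms(1-4)]
    by (simp add: P_HC_def A_HC_balanced[OF assms(1-4)] B_HC_balanced[OF assms(1-4)])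
qed

text \<open>\<open>P_bal\<close> is the root of 2 (P \<open>S_plus\<close> + (1 - P)
  \<open>S_minus\<close>) = 1 - 2 \<delta>, which is linear in P. The bound 0 <= t covers the
  starting point t = 0, which \<open>D_bal\<close> excludes.\<close>

lemma balanced_on_spectral_boundary:
  fixes x t :: real
  assumes x: "0 < x" "x \<le> 1/2" and t: "0 \<le> t" "t < pi / (4 * (1 - x))"
    and P: "0 \<le> P_bal x t \<delta>" "P_bal x t \<delta> \<le> 1" and E: "0 < E_bal x t \<delta>" "E_bal x t \<delta> \<le> 1"
  shows "(x, (sin (x * t))\<^sup>2, (sin ((1 - x) * t))\<^sup>2, z_bal x t \<delta>) \<in> D_HC"
    and "Gamma_HC x ((sin (x * t))\<^sup>2) ((sin ((1 - x) * t))\<^sup>2) (z_bal x t \<delta>) = 1 - 2 * \<delta>"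
proof -
  note PHC = P_HC_z_bal[OF x t E(1)]
  show "(x, (sin (x * t))\<^sup>2, (sin ((1 - x) * t))\<^sup>2, z_bal x t \<delta>) \<in> D_HC"
    using P E by (intro D_HC_balanced[OF x t]) (simp_all only: PHC, simp_all add: z_bal_def)
  have "P_bal x t \<delta> * (S_plus x t - S_minus x t) = (1 - 2 * \<delta>) / 2 - S_minus x t"
    using S_minus_less_S_plus[OF x t] by (simp add: P_bal_def)
  thus "Gamma_HC x ((sin (x * t))\<^sup>2) ((sin ((1 - x) * t))\<^sup>2) (z_bal x t \<delta>) = 1 - 2 * \<delta>"
    unfolding Gamma_HC_balanced[OF x t] PHC by (simp add: algebra_simps)
qed

text \<open>A balanced point satisfies the spectral constraint with equality and is therefore no
  competitor for \<open>kappa_HC\<close>; it is only a limit of competitors with the same x, \<eta>,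
  \<rho> and smaller z.\<close>

lemma kappa_HC_le_kappa_bal:
  assumes "0 < \<delta>" "\<delta> < 1/2"
  shows "kappa_HC \<delta> \<le> kappa_bal \<delta>"
  unfolding kappa_bal_def
proof (rule cInf_greatest[OF kappa_bal_set(1)[OF assms]], clarify)
  fix x t assume "(x, t) \<in> D_bal \<delta>"
  hence x: "0 < x" "x \<le> 1/2" and t: "0 \<le> t" "t < pi / (4 * (1 - x))"
    and P: "0 < P_bal x t \<delta>" "P_bal x t \<delta> < 1" and E: "0 < E_bal x t \<delta>" "E_bal x t \<delta> < 1"
    by (auto simp: D_bal_def)
  define \<eta> where "\<eta> = (sin (x * t))\<^sup>2"
  define \<rho> where "\<rho> = (sin ((1 - x) * t))\<^sup>2"
  define z where "z = z_bal x t \<delta>"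
  have z: "0 < z" "z < 1/2" using E by (auto simp: z_def z_bal_def)
  have Pz: "P_HC x \<eta> \<rho> z = P_bal x t \<delta>"
    unfolding \<eta>_def \<rho>_def z_def by (rule P_HC_z_bal[OF x t E(1)])
  have G: "Gamma_HC x \<eta> \<rho> z = 1 - 2 * \<delta>"
    unfolding \<eta>_def \<rho>_def z_def using P E by (intro balanced_on_spectral_boundary[OF x t]) auto
  note G_eq = Gamma_HC_balanced[OF x t, folded \<eta>_def \<rho>_def]
  have "isCont (P_HC x \<eta> \<rho>) z"
    unfolding P_HC_def E_HC_def divide_inverse by (intro continuous_intros)
  hence "(P_HC x \<eta> \<rho> \<longlongrightarrow> P_bal x t \<delta>) (at_left z)"
    unfolding isCont_def Pz by (rule tendsto_mono[OF at_le, rotated]) simp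
  hence "\<forall>\<^sub>F z' in at_left z. P_HC x \<eta> \<rho> z' < 1"
    using P by (simp add: order_tendstoD)
  moreover have "\<forall>\<^sub>F z' in at_left z. z' \<in> {0<..<z}"
    using z by (intro eventually_at_left_real)
  ultimately have "\<forall>\<^sub>F z' in at_left z. kappa_HC \<delta> \<le> Phi_HC x \<eta> \<rho> z'"
  proof eventually_elim
    \<comment> \<open>Lowering z raises E, hence P, hence \<open>Gamma_HC\<close>, since
      \<open>S_minus\<close> lies below \<open>S_plus\<close>. The point stays in
      \<open>D_HC\<close> because P remains below 1.\<close>
    case (elim z')
    have "(E_HC z)\<^sup>2 < (E_HC z')\<^sup>2"
      using elim z by (intro power_strict_mono) (auto simp: E_HC_def)
    hence Pz': "P_HC x \<eta> \<rho> z < P_HC x \<eta> \<rho> z'"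
      unfolding P_HC_def using A_bal_pos[OF x t] B_bal_pos[OF x t]
      by (intro divide_strict_right_mono)
        (auto simp: A_HC_balanced[OF x t] B_HC_balanced[OF x t] \<eta>_def \<rho>_def)
    have D: "(x, \<eta>, \<rho>, z') \<in> D_HC"
      unfolding \<eta>_def \<rho>_def using elim z P Pz Pz'
      by (intro D_HC_balanced[OF x t]) (auto simp: \<eta>_def \<rho>_def)
    have "P_HC x \<eta> \<rho> z * (S_plus x t - S_minus x t) < P_HC x \<eta> \<rho> z' * (S_plus x t - S_minus x t)"
      using S_minus_less_S_plus[OF x t] Pz' by (intro mult_strict_right_mono) auto
    hence "1 - 2 * \<delta> < Gamma_HC x \<eta> \<rho> z'"
      using G unfolding G_eq by (simp add: algebra_simps)
    thus ?case
      unfolding kappa_HC_def using D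
      by (intro cInf_lower kappa_HC_set(2) assms) blast
  qed
  moreover have "(Phi_HC x \<eta> \<rho> \<longlongrightarrow> Phi_HC x \<eta> \<rho> z) (at_left z)"
    unfolding Phi_HC_def using isCont_H2[of z] z
    by (intro tendsto_intros) (auto simp: isCont_def intro: tendsto_mono[OF at_le])
  ultimately have "kappa_HC \<delta> \<le> Phi_HC x \<eta> \<rho> z"
    by (intro tendsto_lowerbound[where F = "at_left z"]) auto
  also have "\<dots> = Phi_bal x t \<delta>"
    by (simp add: Phi_HC_def Phi_bal_def \<eta>_def \<rho>_def z_def)
  finally show "kappa_HC \<delta> \<le> Phi_bal x t \<delta>" .
qed

section \<open>Smoothness and slope of z along the balanced boundary\<close>

lemma smooth_z_bal:
  assumes "0 < E_bal x 0 \<delta>" and x: "0 < x" "x < 1"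
  obtains D \<epsilon> where "0 < \<epsilon>" "\<And>t. \<bar>t\<bar> < \<epsilon> \<Longrightarrow> D 0 t = z_bal x t \<delta>"
    "\<And>k t. \<bar>t\<bar> < \<epsilon> \<Longrightarrow> (D k has_real_derivative D (Suc k) t) (at t)"
proof -
  \<comment> \<open>All real derivatives exist because \<open>E_bal\<^sup>2\<close> extends to a holomorphic function \<open>F\<close> near 0 that
    avoids the branch cut of the square root.\<close>
  define Sm where "Sm = (\<lambda>w. complex_of_real (sqrt (x * (1 - x))) * sin w)"
  define Sp where "Sp = (\<lambda>w. complex_of_real (sqrt (x * (1 - x))) * cos (complex_of_real (1 - 2 * x) * w))"
  define A where "A = (\<lambda>w. complex_of_real (1 - x) * cos (complex_of_real (2 * x) * w))"
  define B where "B = (\<lambda>w. complex_of_real x * cos (complex_of_real (2 * (1 - x)) * w))"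
  define F where "F = (\<lambda>w. (A w - B w)\<^sup>2 + 4 * A w * B w * ((complex_of_real ((1 - 2 * \<delta>) / 2) - Sm w) / (Sp w - Sm w)))"
  define Fr where "Fr = (\<lambda>t. (A_bal x t - B_bal x t)\<^sup>2 + 4 * A_bal x t * B_bal x t * P_bal x t \<delta>)"
  have F_of_real: "F (of_real t) = of_real (Fr t)" for t
  proof -
    have "A (of_real t) = of_real (A_bal x t)" "B (of_real t) = of_real (B_bal x t)"
      "Sm (of_real t) = of_real (S_minus x t)" "Sp (of_real t) = of_real (S_plus x t)"
      unfolding A_def B_def Sm_def Sp_def A_bal_def B_bal_def S_plus_def S_minus_def
      by (simp_all only: of_real_mult[symmetric] sin_of_real cos_of_real)
    thus ?thesis by (simp add: F_def Fr_def P_bal_def)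
  qed
  \<comment> \<open>At 0 the denominator is sqrt (x (1 - x)) > 0, so 0 lies in
    \<open>U\<close>.\<close>
  define U where "U = {w. Sp w - Sm w \<noteq> 0}"
  have "open U"
    unfolding U_def Sp_def Sm_def by (intro open_Collect_neq continuous_intros)
  have holo_F: "F holomorphic_on U"
    unfolding F_def Sp_def Sm_def A_def B_def
    by (intro holomorphic_intros) (auto simp: U_def Sp_def Sm_def)
  \<comment> \<open>The principal root is holomorphic off the non-positive reals, and
    \<open>F 0\<close> is the positive number \<open>(E_bal x 0 \<delta>)\<^sup>2\<close>, so 0 lies
    in \<open>V\<close>.\<close>
  define V where "V = U \<inter> F -` (- \<real>\<^sub>\<le>\<^sub>0)"
  have "open V"
    unfolding V_def using holo_F \<open>open U\<close>
    by (intro continuous_open_preimage holomorphic_on_imp_continuous_on) auto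
  have "0 \<in> U" using x by (simp add: U_def Sp_def Sm_def)
  moreover have "0 < Fr 0" using assms(1) by (simp add: Fr_def E_bal_def)
  hence "F 0 \<notin> \<real>\<^sub>\<le>\<^sub>0" using F_of_real[of 0] by simp
  ultimately have "0 \<in> V" by (simp add: V_def)
  with \<open>open V\<close> obtain \<epsilon> where \<epsilon>: "\<epsilon> > 0" "ball 0 \<epsilon> \<subseteq> V"
    by (auto simp: open_contains_ball)
  define f where "f = (\<lambda>w. (1 - csqrt (F w)) / 2)"
  have "F holomorphic_on V" using holo_F by (rule holomorphic_on_subset) (auto simp: V_def)
  hence holo_f: "f holomorphic_on V"
    unfolding f_def by (intro holomorphic_intros) (auto simp: V_def)
  have in_V: "of_real t \<in> V" if "\<bar>t\<bar> < \<epsilon>" for t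
    using that by (intro subsetD[OF \<epsilon>(2)]) simp
  \<comment> \<open>Near 0 on the real axis \<open>f\<close> takes real values; the real parts of
    its complex derivatives are the successive real derivatives.\<close>
  define D where "D = (\<lambda>k t. Re ((deriv ^^ k) f (of_real t)))"
  show ?thesis
  proof (rule that[OF \<epsilon>(1), of D])
    fix t :: real assume t: "\<bar>t\<bar> < \<epsilon>"
    hence "F (of_real t) \<notin> \<real>\<^sub>\<le>\<^sub>0" using in_V by (auto simp: V_def)
    hence "0 < Fr t" by (simp add: F_of_real)
    hence "f (of_real t) = of_real ((1 - sqrt (Fr t)) / 2)"
      by (simp add: f_def F_of_real)
    thus "D 0 t = z_bal x t \<delta>"
      by (simp only: D_def z_bal_def E_bal_def Fr_def funpow_0 Re_complex_of_real)
    fix k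
    have "((deriv ^^ k) f has_field_derivative (deriv ^^ Suc k) f (of_real t)) (at (of_real t))"
      by (rule has_field_derivative_higher_deriv[OF holo_f \<open>open V\<close> in_V[OF t]])
    hence "((\<lambda>t. (deriv ^^ k) f (of_real t)) has_vector_derivative (deriv ^^ Suc k) f (of_real t)) (at t)"
      by (rule has_vector_derivative_real_field)
    hence "((\<lambda>t. Re ((deriv ^^ k) f (of_real t))) has_vector_derivative Re ((deriv ^^ Suc k) f (of_real t))) (at t)"
      by (rule bounded_linear.has_vector_derivative[OF bounded_linear_Re])
    thus "(D k has_real_derivative D (Suc k) t) (at t)"
      by (simp only: D_def has_real_derivative_iff_has_vector_derivative)
  qed
qed

text \<open>Put s = sqrt (x (1 - x)). Numerator and denominator both have derivative -s at 0, and
  the denominator equals s there, so the quotient rule gives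
  \<open>P_bal x 0 \<delta> - 1\<close>.\<close>

lemma P_bal_has_derivative_0:
  assumes "0 < x" "x < 1"
  shows "((\<lambda>t. P_bal x t \<delta>) has_real_derivative - (1 - P_bal x 0 \<delta>)) (at 0)"
proof -
  define s where "s = sqrt (x * (1 - x))"
  have "s > 0" using assms by (simp add: s_def)
  thus ?thesis unfolding P_bal_def S_plus_def S_minus_def s_def[symmetric]
    by (auto intro!: derivative_eq_intros simp: field_simps)
qed

text \<open>In E^2 = (A - B)^2 + 4 A B P the factors A and B are even in t, so only P contributes at
  0: (E^2)' = 4 x (1 - x) P', and z' = - (E^2)' / (4 E).\<close>

lemma z_bal_has_derivative_0:
  assumes x: "0 < x" "x < 1" and E: "0 < E_bal x 0 \<delta>"
  shows "((\<lambda>t. z_bal x t \<delta>) has_real_derivative x * (1 - x) * (1 - P_bal x 0 \<delta>) / E_bal x 0 \<delta>) (at 0)"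
proof -
  define F where "F = (\<lambda>t. (A_bal x t - B_bal x t)\<^sup>2 + 4 * A_bal x t * B_bal x t * P_bal x t \<delta>)"
  have "(A_bal x has_real_derivative 0) (at 0)" "(B_bal x has_real_derivative 0) (at 0)"
    unfolding A_bal_def B_bal_def by (auto intro!: derivative_eq_intros)
  hence "(F has_real_derivative - 4 * (x * (1 - x)) * (1 - P_bal x 0 \<delta>)) (at 0)"
    unfolding F_def using P_bal_has_derivative_0[OF x, of \<delta>]
    by (auto intro!: derivative_eq_intros simp: A_bal_def B_bal_def algebra_simps)
  moreover have "0 < F 0" using E by (simp add: E_bal_def F_def)
  ultimately have "((\<lambda>t. (1 - sqrt (F t)) / 2) has_real_derivative
      x * (1 - x) * (1 - P_bal x 0 \<delta>) / sqrt (F 0)) (at 0)"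
    by (auto intro!: derivative_eq_intros simp: field_simps)
  thus ?thesis by (simp add: z_bal_def E_bal_def F_def)
qed

text \<open>The composite is twice continuously differentiable because \<open>f\<close> stays inside
  (0, 1), away from the singularities of the derivatives of \<open>H2\<close>.\<close>

lemma H2_comp_taylor:
  assumes "\<epsilon> > 0"
    and f: "\<And>t. t \<in> {0..<\<epsilon>} \<Longrightarrow> (f has_real_derivative f1 t) (at t)"
    and f1: "\<And>t. t \<in> {0..<\<epsilon>} \<Longrightarrow> (f1 has_real_derivative f2 t) (at t)"
    and f2: "continuous_on {0..<\<epsilon>} f2"
    and range: "\<And>t. t \<in> {0..<\<epsilon>} \<Longrightarrow> f t \<in> {0<..<1}"
  shows "(\<lambda>t. H2 (f t) - (H2 (f 0) + deriv H2 (f 0) * f1 0 * t)) \<in> O[at_right 0](\<lambda>t. t\<^sup>2)"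
proof -
  define g where "g = (\<lambda>t. (log 2 (1 - f t) - log 2 (f t)) * f1 t)"
  define g' where "g' = (\<lambda>t. - (1 / (1 - f t) + 1 / f t) / ln 2 * (f1 t)\<^sup>2 + (log 2 (1 - f t) - log 2 (f t)) * f2 t)"
  have "(\<lambda>t. H2 (f t) - (H2 (f 0) + g 0 * t)) \<in> O[at_right 0](\<lambda>t. t\<^sup>2)"
  proof (rule second_order_taylor_bigo[OF \<open>\<epsilon> > 0\<close>, where f = "\<lambda>t. H2 (f t)" and ?f1.0 = g and ?f2.0 = g'])
    fix t assume t: "t \<in> {0..<\<epsilon>}"
    show "((\<lambda>t. H2 (f t)) has_real_derivative g t) (at t)"
      unfolding g_def using range[OF t] by (intro DERIV_chain2[OF H2_has_real_derivative] f t) auto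
    show "(g has_real_derivative g' t) (at t)"
      unfolding g_def g'_def using range[OF t] f[OF t] f1[OF t]
      by (auto intro!: derivative_eq_intros simp: power2_eq_square field_simps)
  next
    have "continuous_on {0..<\<epsilon>} f" "continuous_on {0..<\<epsilon>} f1"
      by (auto intro!: continuous_at_imp_continuous_on DERIV_isCont[OF f] DERIV_isCont[OF f1])
    thus "continuous_on {0..<\<epsilon>} g'"
      unfolding g'_def using range f2 by (intro continuous_intros) fastforce+
  qed
  moreover have "deriv H2 (f 0) = log 2 (1 - f 0) - log 2 (f 0)"
    using range[of 0] \<open>\<epsilon> > 0\<close> by (intro deriv_H2) auto
  ultimately show ?thesis by (simp add: g_def)
qed

section \<open>Expansion of z and of the objective at a minimizer\<close>

text \<open>Rests on (a - b) (1 - a - b) = a (1 - a) - b (1 - b); it reconciles the two expressions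
  for q.\<close>

lemma one_minus_P0:
  fixes a b :: real
  assumes "0 < a" "a < 1"
  shows "1 - (a - b) * (1 - a - b) / (a * (1 - a)) = b * (1 - b) / (a * (1 - a))"
proof -
  have "b * (1 - b) = a * (1 - a) - (a - b) * (1 - a - b)" by (simp add: algebra_simps)
  moreover have "a * (1 - a) / (a * (1 - a)) = 1" using assms by simp
  ultimately show ?thesis by (simp only: diff_divide_distrib)
qed

text \<open>At t = 0 the tight constraint \<open>Gamma_H a b = 1 - 2 * \<delta>\<close> determines
  P, and (1 - 2 a)^2 + 4 (a - b) (1 - a - b) = (1 - 2 b)^2 gives E. So the balanced curve starts at
  the whole-cube minimizer, with z = b.\<close>

lemma minimizer_balanced_at_0:
  assumes "0 < \<delta>" "\<delta> < 1/2" and "closed_whole_cube_minimizer \<delta> (a, b)"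
  shows "P_bal a 0 \<delta> = (a - b) * (1 - a - b) / (a * (1 - a))" and "E_bal a 0 \<delta> = 1 - 2 * b"
proof -
  note ab = closed_whole_cube_minimizer_interior[OF assms]
  define s where "s = sqrt (a * (1 - a))"
  have "0 < s" "a * (1 - a) = s * s" using ab by (simp_all add: s_def)
  moreover have "Gamma_H a b = 2 * ((a - b) * (1 - a - b)) / s"
    by (simp only: Gamma_H_def s_def mult.assoc)
  ultimately have "(a - b) * (1 - a - b) / (a * (1 - a)) = Gamma_H a b / 2 / sqrt (a * (1 - a))"
    by (simp only: flip: s_def) simp
  thus P: "P_bal a 0 \<delta> = (a - b) * (1 - a - b) / (a * (1 - a))"
    by (simp add: P_bal_def S_plus_def S_minus_def ab)
  have "4 * (1 - a) * a * P_bal a 0 \<delta> = 4 * ((a - b) * (1 - a - b))"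
    unfolding P using ab by (simp add: field_simps)
  hence "E_bal a 0 \<delta> = sqrt ((1 - 2 * a)\<^sup>2 + 4 * ((a - b) * (1 - a - b)))"
    by (simp add: E_bal_def A_bal_def B_bal_def)
  also have "(1 - 2 * a)\<^sup>2 + 4 * ((a - b) * (1 - a - b)) = (1 - 2 * b)\<^sup>2"
    by (simp add: power2_eq_square algebra_simps)
  finally show "E_bal a 0 \<delta> = 1 - 2 * b" using ab by simp
qed

text \<open>Gathers the facts about the curve on one interval. At t = 0 the open conditions hold, as
  0 < b < a <= 1/2 gives 0 < P < 1 and puts E = 1 - 2 b in (0, 1), so they persist for small
  t.\<close>

lemma balanced_expansion:
  assumes \<delta>: "0 < \<delta>" "\<delta> < 1/2" and min: "closed_whole_cube_minimizer \<delta> (a, b)"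
  defines "q \<equiv> b * (1 - b) / (1 - 2 * b)"
  obtains \<epsilon> where "\<epsilon> > 0"
    "smooth_real_on {0..<\<epsilon>} (\<lambda>t. z_bal a t \<delta>)"
    "\<And>t. t \<in> {0..<\<epsilon>} \<Longrightarrow> t < pi / (4 * (1 - a)) \<and> P_bal a t \<delta> \<in> {0<..<1} \<and> E_bal a t \<delta> \<in> {0<..<1}"
    "(\<lambda>t. z_bal a t \<delta> - (b + q * t)) \<in> O[at_right 0](\<lambda>t. t\<^sup>2)"
    "(\<lambda>t. H2 (z_bal a t \<delta>) - (H2 b + deriv H2 b * q * t)) \<in> O[at_right 0](\<lambda>t. t\<^sup>2)"
proof -
  note ab = closed_whole_cube_minimizer_interior[OF \<delta> min] and at_0 = minimizer_balanced_at_0[OF \<delta> min]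
  have a: "0 < a" "a < 1" and b: "b < 1/2" using ab by auto
  have E0: "0 < E_bal a 0 \<delta>" using at_0 b by simp
  have z0: "z_bal a 0 \<delta> = b" by (simp add: z_bal_def at_0)
  obtain D \<epsilon>\<^sub>0 where D: "0 < \<epsilon>\<^sub>0" "\<And>t. \<bar>t\<bar> < \<epsilon>\<^sub>0 \<Longrightarrow> D 0 t = z_bal a t \<delta>"
    "\<And>k t. \<bar>t\<bar> < \<epsilon>\<^sub>0 \<Longrightarrow> (D k has_real_derivative D (Suc k) t) (at t)"
    using smooth_z_bal[OF E0 a] by metis
  have P1: "1 - P_bal a 0 \<delta> = b * (1 - b) / (a * (1 - a))"
    unfolding at_0 by (rule one_minus_P0[OF a])
  hence q: "a * (1 - a) * (1 - P_bal a 0 \<delta>) / E_bal a 0 \<delta> = q"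
    using a by (simp add: at_0 q_def)
  have z_deriv_0: "((\<lambda>t. z_bal a t \<delta>) has_real_derivative q) (at 0)"
    using z_bal_has_derivative_0[OF a E0] unfolding q .
  \<comment> \<open>\<open>D 0\<close> agrees with \<open>z_bal\<close> near 0, so uniqueness of
    derivatives turns the computed slope q into the value of \<open>D 1 0\<close>.\<close>
  have "(D 0 has_real_derivative q) (at 0)"
    by (rule has_field_derivative_transform_within[OF z_deriv_0 D(1)])
       (use D in \<open>auto simp: dist_real_def\<close>)
  hence D_1: "D 1 0 = q"
    using D(3)[of 0 0] D(1) by (simp add: DERIV_unique)
  \<comment> \<open>Neighbourhood filters are used so that the conditions also hold at t = 0
    itself.\<close>
  have nhds: "(f \<longlongrightarrow> f 0) (nhds 0)" if "isCont f 0" for f :: "real \<Rightarrow> real"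
    using that by (simp add: isCont_def tendsto_at_iff_tendsto_nhds)
  have "isCont (\<lambda>t. P_bal a t \<delta>) 0"
    using P_bal_has_derivative_0[OF a] by (rule DERIV_isCont)
  moreover have P0: "0 < P_bal a 0 \<delta>" "P_bal a 0 \<delta> < 1"
  proof -
    show "0 < P_bal a 0 \<delta>" using ab a by (simp add: at_0)
    have "0 < b * (1 - b) / (a * (1 - a))" using ab a by simp
    thus "P_bal a 0 \<delta> < 1" using P1 by linarith
  qed
  ultimately have "\<forall>\<^sub>F t in nhds 0. 0 < P_bal a t \<delta>" "\<forall>\<^sub>F t in nhds 0. P_bal a t \<delta> < 1"
    by (auto dest!: nhds intro: order_tendstoD)
  moreover have "E_bal a t \<delta> = 1 - 2 * z_bal a t \<delta>" for t
    by (simp add: z_bal_def diff_divide_distrib)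
  hence "isCont (\<lambda>t. E_bal a t \<delta>) 0"
    using DERIV_isCont[OF z_deriv_0] by simp
  hence "\<forall>\<^sub>F t in nhds 0. 0 < E_bal a t \<delta>" "\<forall>\<^sub>F t in nhds 0. E_bal a t \<delta> < 1"
    using at_0 ab b by (auto dest!: nhds intro: order_tendstoD)
  moreover have "\<forall>\<^sub>F t in nhds 0. t < pi / (4 * (1 - a))"
    using a by (intro eventually_nhds_in_open[of "{..<_}", simplified]) auto
  ultimately have "\<forall>\<^sub>F t in nhds 0. t < pi / (4 * (1 - a)) \<and> P_bal a t \<delta> \<in> {0<..<1} \<and> E_bal a t \<delta> \<in> {0<..<1}"
    by eventually_elim auto
  then obtain \<epsilon>\<^sub>1 where \<epsilon>\<^sub>1: "\<epsilon>\<^sub>1 > 0" "\<And>t. \<bar>t\<bar> < \<epsilon>\<^sub>1 \<Longrightarrow>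
      t < pi / (4 * (1 - a)) \<and> P_bal a t \<delta> \<in> {0<..<1} \<and> E_bal a t \<delta> \<in> {0<..<1}"
    by (auto simp: eventually_nhds_metric dist_real_def)
  define \<epsilon> where "\<epsilon> = min \<epsilon>\<^sub>0 \<epsilon>\<^sub>1"
  have \<epsilon>: "\<epsilon> > 0" "\<epsilon> \<le> \<epsilon>\<^sub>0" "\<epsilon> \<le> \<epsilon>\<^sub>1" using D \<epsilon>\<^sub>1 by (auto simp: \<epsilon>_def)
  define z where "z = (\<lambda>t. z_bal a t \<delta>)"
  have z: "(z has_real_derivative D 1 t) (at t)" if "t \<in> {0..<\<epsilon>}" for t
  proof (rule has_field_derivative_transform_within)
    show "(D 0 has_real_derivative D 1 t) (at t)" using D(3)[of t 0] that \<epsilon> by simp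
    \<comment> \<open>The ball of this radius about t lies in (-\<epsilon>, \<epsilon>), since t >=
      0.\<close>
    show "0 < \<epsilon> - t" using that by simp
    show "D 0 t' = z t'" if "dist t' t < \<epsilon> - t" for t'
      using that \<open>t \<in> _\<close> \<epsilon> unfolding z_def by (intro D) (auto simp: dist_real_def)
  qed simp
  have z1: "(D 1 has_real_derivative D 2 t) (at t)" if "t \<in> {0..<\<epsilon>}" for t
    using D(3)[of t 1] that \<epsilon> by (simp add: numeral_2_eq_2)
  have z2: "continuous_on {0..<\<epsilon>} (D 2)"
  proof (intro continuous_at_imp_continuous_on ballI)
    fix t assume "t \<in> {0..<\<epsilon>}"
    thus "isCont (D 2) t" using D(3)[of t 2] \<epsilon> by (intro DERIV_isCont[of _ "D 3 t"]) (simp add: numeral_3_eq_3 numeral_2_eq_2)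
  qed
  show ?thesis
  proof (rule that[OF \<epsilon>(1)])
    show "smooth_real_on {0..<\<epsilon>} (\<lambda>t. z_bal a t \<delta>)"
      unfolding smooth_real_on_def
    \<comment> \<open>\<open>smooth_real_on\<close> asks for the zeroth entry to equal the function
      everywhere, but \<open>D 0\<close> is known to be \<open>z_bal\<close> only near 0; hence that
      entry is replaced.\<close>
    proof (intro exI[of _ "D(0 := z)"] conjI allI ballI)
      fix k t assume t: "t \<in> {0..<\<epsilon>}"
      show "((D(0 := z)) k has_real_derivative (D(0 := z)) (Suc k) t) (at t within {0..<\<epsilon>})"
      proof (cases "k = 0")
        case True thus ?thesis using z[OF t] by (simp add: has_field_derivative_at_within)
      next
        case False thus ?thesis using D(3)[of t k] t \<epsilon> by (simp add: has_field_derivative_at_within)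
      qed
    qed (simp add: z_def)
    show "t < pi / (4 * (1 - a)) \<and> P_bal a t \<delta> \<in> {0<..<1} \<and> E_bal a t \<delta> \<in> {0<..<1}"
      if "t \<in> {0..<\<epsilon>}" for t
      using that \<epsilon> by (intro \<epsilon>\<^sub>1) auto
    show "(\<lambda>t. z_bal a t \<delta> - (b + q * t)) \<in> O[at_right 0](\<lambda>t. t\<^sup>2)"
      using second_order_taylor_bigo[OF \<epsilon>(1) z z1 z2] by (simp only: D_1 z_def z0)
    have "z t \<in> {0<..<1}" if "t \<in> {0..<\<epsilon>}" for t
      using \<epsilon>\<^sub>1(2)[of t] that \<epsilon> by (auto simp: z_def z_bal_def)
    from H2_comp_taylor[OF \<epsilon>(1) z z1 z2 this]
    show "(\<lambda>t. H2 (z_bal a t \<delta>) - (H2 b + deriv H2 b * q * t)) \<in> O[at_right 0](\<lambda>t. t\<^sup>2)"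
      by (simp only: D_1 z_def z0)
  qed
qed

text \<open>The logarithmic coefficients add up to (1 - a) 2 a^2 + a 2 (1 - a)^2 = 2 a (1 - a); the
  linear term comes from the entropy of z alone, and the constant term \<open>H2 a - H2 b\<close> is
  \<open>kappa_H \<delta>\<close>.\<close>

lemma Phi_bal_expansion:
  assumes \<delta>: "0 < \<delta>" "\<delta> < 1/2" and min: "closed_whole_cube_minimizer \<delta> (a, b)"
  defines "q \<equiv> b * (1 - b) / (1 - 2 * b)"
  shows "(\<lambda>t. Phi_bal a t \<delta> -
      (kappa_H \<delta> - q * deriv H2 b * t + 2 * a * (1 - a) * t\<^sup>2 * log 2 (1 / t))) \<in> O[at_right 0](\<lambda>t. t\<^sup>2)"
proof -
  have a: "0 < a" "0 < 1 - a" using closed_whole_cube_minimizer_interior[OF \<delta> min] by auto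
  have z: "(\<lambda>t. H2 (z_bal a t \<delta>) - (H2 b + deriv H2 b * q * t)) \<in> O[at_right 0](\<lambda>t. t\<^sup>2)"
    using balanced_expansion[OF \<delta> min] unfolding q_def by metis
  have "(\<lambda>t. (1 - a) * (H2 ((sin (a * t))\<^sup>2) - 2 * a\<^sup>2 * t\<^sup>2 * log 2 (1 / t))
      + a * (H2 ((sin ((1 - a) * t))\<^sup>2) - 2 * (1 - a)\<^sup>2 * t\<^sup>2 * log 2 (1 / t))
      - (H2 (z_bal a t \<delta>) - (H2 b + deriv H2 b * q * t))) \<in> O[at_right 0](\<lambda>t. t\<^sup>2)"
    by (intro sum_in_bigo z landau_o.big.cmult_in_iff[THEN iffD2] disjI2 H2_sin_squared_expansion a)
       (use a in auto)
  also have "(\<lambda>t. (1 - a) * (H2 ((sin (a * t))\<^sup>2) - 2 * a\<^sup>2 * t\<^sup>2 * log 2 (1 / t))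
      + a * (H2 ((sin ((1 - a) * t))\<^sup>2) - 2 * (1 - a)\<^sup>2 * t\<^sup>2 * log 2 (1 / t))
      - (H2 (z_bal a t \<delta>) - (H2 b + deriv H2 b * q * t))) =
    (\<lambda>t. Phi_bal a t \<delta> -
      (kappa_H \<delta> - q * deriv H2 b * t + 2 * a * (1 - a) * t\<^sup>2 * log 2 (1 / t)))"
    by (rule ext) (simp add: Phi_bal_def kappa_H_eq[OF \<delta> min] power2_eq_square algebra_simps)
  finally show ?thesis .
qed

section \<open>Strict improvement over the whole-cube exponent\<close>

lemma kappa_bal_less_kappa_H:
  assumes \<delta>: "0 < \<delta>" "\<delta> < 1/2"
  shows "kappa_bal \<delta> < kappa_H \<delta>"
proof -
  obtain a b where min: "closed_whole_cube_minimizer \<delta> (a, b)"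
    using closed_whole_cube_minimizer_exists[OF \<delta>] .
  note ab = closed_whole_cube_minimizer_interior[OF \<delta> min]
  define q where "q = b * (1 - b) / (1 - 2 * b)"
  have c: "0 < q * deriv H2 b"
    using ab by (intro mult_pos_pos deriv_H2_pos) (auto simp: q_def)
  obtain \<epsilon> where \<epsilon>: "\<epsilon> > 0" "\<And>t. t \<in> {0..<\<epsilon>} \<Longrightarrow>
      t < pi / (4 * (1 - a)) \<and> P_bal a t \<delta> \<in> {0<..<1} \<and> E_bal a t \<delta> \<in> {0<..<1}"
    using balanced_expansion[OF \<delta> min] by metis
  have "(\<lambda>t. Phi_bal a t \<delta> - (kappa_H \<delta> - q * deriv H2 b * t + 2 * a * (1 - a) * t\<^sup>2 * log 2 (1 / t)))
      \<in> O[at_right 0](\<lambda>t. t\<^sup>2)"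
    unfolding q_def by (rule Phi_bal_expansion[OF \<delta> min])
  \<comment> \<open>Both the O(t^2) error and the entropy cost t^2 log (1/t) are o(t), which leaves
    only the linear gain.\<close>
  also have "(\<lambda>t::real. t\<^sup>2) \<in> o[at_right 0](\<lambda>t. t)" by real_asymp
  finally have "(\<lambda>t. (Phi_bal a t \<delta> - (kappa_H \<delta> - q * deriv H2 b * t + 2 * a * (1 - a) * t\<^sup>2 * log 2 (1 / t)))
      + 2 * a * (1 - a) * (t\<^sup>2 * log 2 (1 / t))) \<in> o[at_right 0](\<lambda>t. t)"
  proof (rule sum_in_smallo)
    have "(\<lambda>t::real. t\<^sup>2 * log 2 (1 / t)) \<in> o[at_right 0](\<lambda>t. t)"
      unfolding log_def by real_asymp
    thus "(\<lambda>t. 2 * a * (1 - a) * (t\<^sup>2 * log 2 (1 / t))) \<in> o[at_right 0](\<lambda>t. t)"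
      by simp
  qed
  hence "(\<lambda>t. Phi_bal a t \<delta> - (kappa_H \<delta> - q * deriv H2 b * t)) \<in> o[at_right 0](\<lambda>t. t)"
    by (simp add: algebra_simps)
  \<comment> \<open>Half of the linear gain serves as tolerance for the error, so the other half
    remains.\<close>
  moreover have "0 < q * deriv H2 b / 2" using c by simp
  ultimately have "\<forall>\<^sub>F t in at_right 0.
      norm (Phi_bal a t \<delta> - (kappa_H \<delta> - q * deriv H2 b * t)) \<le> q * deriv H2 b / 2 * norm t"
    by (rule landau_o.smallD)
  moreover have "\<forall>\<^sub>F t in at_right 0. t \<in> {0<..<\<epsilon>}"
    using \<epsilon>(1) by (rule eventually_at_right_real)
  ultimately have "\<forall>\<^sub>F t in at_right 0. t \<in> {0<..<\<epsilon>} \<and> Phi_bal a t \<delta> < kappa_H \<delta>"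
  proof eventually_elim
    case (elim t)
    hence "0 < q * deriv H2 b * t" using c by simp
    moreover have "\<bar>Phi_bal a t \<delta> - (kappa_H \<delta> - q * deriv H2 b * t)\<bar> \<le> q * deriv H2 b * t / 2"
      using elim by simp
    ultimately have "Phi_bal a t \<delta> < kappa_H \<delta>" by linarith
    with elim show ?case by simp
  qed
  then obtain t where t: "t \<in> {0<..<\<epsilon>}" "Phi_bal a t \<delta> < kappa_H \<delta>"
    using eventually_happens'[OF trivial_limit_at_right_real] by blast
  have "(a, t) \<in> D_bal \<delta>" using \<epsilon>(2)[of t] t ab by (auto simp: D_bal_def)
  hence "kappa_bal \<delta> \<le> Phi_bal a t \<delta>"
    unfolding kappa_bal_def by (intro cInf_lower kappa_bal_set(2) \<delta>) blast
  with t show ?thesis by simp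
qed

theorem theorem5p5:
  fixes \<delta> :: real
  assumes "0 < \<delta>" and "\<delta> < 1/2"
  shows "kappa_HC \<delta> \<le> kappa_bal \<delta> \<and> kappa_bal \<delta> < kappa_H \<delta> \<and>
    (\<forall>a b :: real. closed_whole_cube_minimizer \<delta> (a, b) \<longrightarrow>
      (let P0 = (a - b) * (1 - a - b) / (a * (1 - a));
           q = a * (1 - a) * (1 - P0) / (1 - 2 * b)
       in q = b * (1 - b) / (1 - 2 * b) \<and> q > 0 \<and>
          (\<exists>(z :: real \<Rightarrow> real) \<epsilon>. \<epsilon> > 0 \<and> smooth_real_on {0..<\<epsilon>} z \<and>
             (\<forall>t\<in>{0..<\<epsilon>}. (a, (sin (a * t))\<^sup>2, (sin ((1 - a) * t))\<^sup>2, z t) \<in> D_HC \<and>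
                Gamma_HC a ((sin (a * t))\<^sup>2) ((sin ((1 - a) * t))\<^sup>2) (z t) = 1 - 2 * \<delta>) \<and>
             (\<forall>t\<in>{0<..<\<epsilon>}. (a, t) \<in> D_bal \<delta> \<and> z t = z_bal a t \<delta>) \<and>
             (\<lambda>t. z t - (b + q * t)) \<in> O[at_right 0](\<lambda>t. t\<^sup>2)) \<and>
          (\<lambda>t. Phi_bal a t \<delta> -
             (kappa_H \<delta> - q * deriv H2 b * t + 2 * a * (1 - a) * t\<^sup>2 * log 2 (1 / t)))
            \<in> O[at_right 0](\<lambda>t. t\<^sup>2)))"
proof (intro conjI allI impI)
  show "kappa_HC \<delta> \<le> kappa_bal \<delta>" by (rule kappa_HC_le_kappa_bal[OF assms])
  show "kappa_bal \<delta> < kappa_H \<delta>" by (rule kappa_bal_less_kappa_H[OF assms])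
next
  fix a b assume min: "closed_whole_cube_minimizer \<delta> (a, b)"
  note ab = closed_whole_cube_minimizer_interior[OF assms min]
  define q where "q = b * (1 - b) / (1 - 2 * b)"
  have q: "a * (1 - a) * (1 - (a - b) * (1 - a - b) / (a * (1 - a))) / (1 - 2 * b) = q"
    using ab by (simp add: one_minus_P0 q_def)
  have "q > 0" using ab by (simp add: q_def)
  obtain \<epsilon> where \<epsilon>: "\<epsilon> > 0" "smooth_real_on {0..<\<epsilon>} (\<lambda>t. z_bal a t \<delta>)"
    "\<And>t. t \<in> {0..<\<epsilon>} \<Longrightarrow> t < pi / (4 * (1 - a)) \<and> P_bal a t \<delta> \<in> {0<..<1} \<and> E_bal a t \<delta> \<in> {0<..<1}"
    "(\<lambda>t. z_bal a t \<delta> - (b + q * t)) \<in> O[at_right 0](\<lambda>t. t\<^sup>2)"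
    using balanced_expansion[OF assms min] unfolding q_def by metis
  \<comment> \<open>These statements include t = 0, where membership in \<open>D_bal\<close> fails
    because it requires t > 0; hence \<open>D\<close> below is confined to positive t.\<close>
  have boundary: "(a, (sin (a * t))\<^sup>2, (sin ((1 - a) * t))\<^sup>2, z_bal a t \<delta>) \<in> D_HC \<and>
      Gamma_HC a ((sin (a * t))\<^sup>2) ((sin ((1 - a) * t))\<^sup>2) (z_bal a t \<delta>) = 1 - 2 * \<delta>"
    if "t \<in> {0..<\<epsilon>}" for t
    using \<epsilon>(3)[OF that] that ab by (intro conjI balanced_on_spectral_boundary) auto
  have D: "(a, t) \<in> D_bal \<delta>" if "t \<in> {0<..<\<epsilon>}" for t
    using \<epsilon>(3)[of t] that ab by (auto simp: D_bal_def)
  show "let P0 = (a - b) * (1 - a - b) / (a * (1 - a));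
           q = a * (1 - a) * (1 - P0) / (1 - 2 * b)
       in q = b * (1 - b) / (1 - 2 * b) \<and> q > 0 \<and>
          (\<exists>(z :: real \<Rightarrow> real) \<epsilon>. \<epsilon> > 0 \<and> smooth_real_on {0..<\<epsilon>} z \<and>
             (\<forall>t\<in>{0..<\<epsilon>}. (a, (sin (a * t))\<^sup>2, (sin ((1 - a) * t))\<^sup>2, z t) \<in> D_HC \<and>
                Gamma_HC a ((sin (a * t))\<^sup>2) ((sin ((1 - a) * t))\<^sup>2) (z t) = 1 - 2 * \<delta>) \<and>
             (\<forall>t\<in>{0<..<\<epsilon>}. (a, t) \<in> D_bal \<delta> \<and> z t = z_bal a t \<delta>) \<and>
             (\<lambda>t. z t - (b + q * t)) \<in> O[at_right 0](\<lambda>t. t\<^sup>2)) \<and>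
          (\<lambda>t. Phi_bal a t \<delta> -
             (kappa_H \<delta> - q * deriv H2 b * t + 2 * a * (1 - a) * t\<^sup>2 * log 2 (1 / t)))
            \<in> O[at_right 0](\<lambda>t. t\<^sup>2)"
    unfolding Let_def q
    using q_def \<open>q > 0\<close> \<epsilon> boundary D Phi_bal_expansion[OF assms min, folded q_def]
    by (intro conjI exI[of _ "\<lambda>t. z_bal a t \<delta>"] exI[of _ \<epsilon>]) auto
qed

end
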